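(* Let $n\ge 1$ and let $X_1,\ldots,X_n$ be independent real-valued random variables. Suppose that for each $i=1,\ldots,n$ there are real numbers $\mu_i$, $M_i$ and $\sigma_i>0$ with $\mathrm{E}[X_i]=\mu_i$, $\mathrm{E}[(X_i-\mu_i)^2]=\sigma_i^2$ and $\Pr(X_i\in(-\infty,M_i])=1$. Put $$s_i = M_i-\mu_i,\qquad s=\frac1n\sum_{i=1}^n s_i .$$ Then for every $t\in(0,s)$, $$\Pr\left(\frac1n\sum_{i=1}^n X_i-\frac1n\sum_{i=1}^n \mathrm{E}[X_i]\ge t\right)\le e^{-\lambda n t}\prod_{i=1}^n\left(\frac{\sigma_i^2}{s_i^2}\left(e^{\lambda s_i}-1-\lambda s_i\right)+1\right),$$ where $$\lambda=\frac{1}{\sum_{i=1}^n \frac{s_i^2}{1-e^{-s_i^2/\sigma_i^2}}}\sum_{i=1}^n\frac{s_i^2\lambda_i}{1-e^{-s_i^2/\sigma_i^2}}$$ and, for $i=1,\ldots,n$, $$\lambda_i=\frac{s}{t s_i}+\frac{s_i}{\sigma_i^2}-\frac1{s_i}-\frac1{s_i}\mathcal{W}\left(\exp\left(\frac st+\frac{s_i^2}{\sigma_i^2}-1+\ln\left(\frac{s-t}{t}\right)\right)\right).$$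
   Context: $\mathcal{W}$ denotes the principal branch of Lambert's function: for $y>0$, $\mathcal{W}(y)$ is the unique real $w>0$ with $w e^{w}=y$. *)

theory Defs
  imports "HOL-Probability.Probability"
begin

text \<open>Principal branch of Lambert's function on the positive reals; the value is unspecified
  for \<open>y \<le> 0\<close>.\<close>

definition lambert_W :: "real \<Rightarrow> real" where
  "lambert_W y = (THE w. 0 < w \<and> w * exp w = y)"

lemma lambert_W_ex1:
  fixes y :: real
  assumes "0 < y"
  shows "\<exists>!w. 0 < w \<and> w * exp w = y"
proof -
  have "\<exists>w\<ge>0. w \<le> y \<and> w * exp w = y"
    using assms by (intro IVT) (auto intro!: continuous_intros)
  then obtain w where w: "0 \<le> w" "w * exp w = y" by blast
  with assms have "0 < w" by (cases "w = 0") auto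
  have "v = w" if "0 < v" "v * exp v = y" for v
  proof (rule ccontr)
    assume "v \<noteq> w"
    then consider "v < w" | "w < v" by linarith
    then show False
    proof cases
      case 1
      then have "v * exp v < w * exp w" using that by (intro mult_strict_mono) auto
      with that w show False by simp
    next
      case 2
      then have "w * exp w < v * exp v" using \<open>0 < w\<close> by (intro mult_strict_mono) auto
      with that w show False by simp
    qed
  qed
  with w \<open>0 < w\<close> show ?thesis by blast
qed

end

theory Submission
  imports Defs
begin

text \<open>Since \<open>(e\<^sup>x - 1 - x) / x\<^sup>2\<close> is increasing, a centred random variable bounded above by \<open>b\<close> with
  variance \<open>v\<close> satisfies Bennett's estimate \<open>E e\<^bsup>\<lambda>Y\<^esup> \<le> 1 + v/b\<^sup>2 (e\<^bsup>\<lambda>b\<^esup> - 1 - \<lambda>b)\<close> for every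
  \<open>\<lambda> > 0\<close>, and the Chernoff bound together with independence gives the claimed inequality for every
  such \<open>\<lambda>\<close>. The specific \<open>\<lambda>\<close> of the theorem is a weighted mean of the \<open>\<lambda>\<^sub>i\<close>, each of which is
  positive because \<open>W (e\<^sup>A (s/t - 1)) < A\<close> for \<open>A = s/t + s\<^sub>i\<^sup>2/\<sigma>\<^sub>i\<^sup>2 - 1 > s/t - 1\<close>.\<close>

text \<open>On the nonnegative reals \<open>w * exp w\<close> is increasing, so
  \<open>a \<le> lambert_W y\<close> would force \<open>a * exp a \<le> y\<close>. Positivity of
  \<open>y\<close> ensures that the description in \<open>lambert_W\<close> has a unique
  witness.\<close>

lemma lambert_W_less:
  fixes y a :: real
  assumes "0 < y" and "0 < a" and "y < a * exp a"
  shows "lambert_W y < a"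
proof (rule ccontr)
  have W: "lambert_W y * exp (lambert_W y) = y"
    using theI'[OF lambert_W_ex1[OF assms(1)]] unfolding lambert_W_def by blast
  assume "\<not> lambert_W y < a"
  then have "a * exp a \<le> lambert_W y * exp (lambert_W y)"
    using assms(2) by (intro mult_mono) auto
  with W assms(3) show False by simp
qed

text \<open>Shifting the index by 2 exposes a factor \<open>x\<^sup>2\<close> in every term, ready
  for a termwise comparison.\<close>

lemma exp_minus_linear_sums:
  fixes x :: real
  shows "(\<lambda>k. x ^ (k + 2) / fact (k + 2)) sums (exp x - 1 - x)"
proof -
  have "(\<lambda>k. x ^ k / fact k) sums exp x"
    using exp_converges[of x] by (simp add: field_simps)
  then show ?thesis
    by (subst sums_iff_shift) (simp add: numeral_2_eq_2)
qed

text \<open>The third-order Lagrange remainder has the sign of \<open>x ^ 3\<close>.\<close>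

lemma exp_le_quadratic_of_nonpos:
  fixes x :: real
  assumes "x \<le> 0"
  shows "exp x \<le> 1 + x + x\<^sup>2 / 2"
proof -
  obtain r where "exp x = (\<Sum>m<3. x ^ m / fact m) + exp r / fact 3 * x ^ 3"
    using Maclaurin_exp_le[of x 3] by blast
  moreover have "exp r / fact 3 * x ^ 3 \<le> 0"
    using assms by (intro mult_nonneg_nonpos) (auto simp: power_le_zero_eq)
  ultimately show ?thesis
    by (simp add: eval_nat_numeral)
qed

text \<open>Cleared of denominators, the monotonicity of the remainder ratio also makes sense at
  \<open>x = 0\<close>. For \<open>0 \<le> x\<close> the two series are compared term by term; for
  negative \<open>x\<close> the value 1/2 separates the two ratios.\<close>

lemma exp_remainder_ratio_mono:
  fixes x u :: real
  assumes "x \<le> u" and "0 < u"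
  shows "u\<^sup>2 * (exp x - 1 - x) \<le> x\<^sup>2 * (exp u - 1 - u)"
proof (cases "0 \<le> x")
  case True
  have "u\<^sup>2 * (x ^ (k + 2) / fact (k + 2)) \<le> x\<^sup>2 * (u ^ (k + 2) / fact (k + 2))" for k
  proof -
    \<comment> \<open>Both terms share the factor \<open>(x * u)\<^sup>2 / fact (k + 2)\<close>,
      which leaves only \<open>x ^ k \<le> u ^ k\<close>.\<close>
    have "u\<^sup>2 * (x ^ (k + 2) / fact (k + 2)) = (x * u)\<^sup>2 / fact (k + 2) * x ^ k"
      by (simp add: power_add power_mult_distrib power2_eq_square)
    also have "\<dots> \<le> (x * u)\<^sup>2 / fact (k + 2) * u ^ k"
      using True assms by (intro mult_left_mono power_mono) auto
    also have "\<dots> = x\<^sup>2 * (u ^ (k + 2) / fact (k + 2))"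
      by (simp add: power_add power_mult_distrib power2_eq_square)
    finally show ?thesis .
  qed
  then show ?thesis
    by (rule sums_le[OF _ sums_mult[OF exp_minus_linear_sums] sums_mult[OF exp_minus_linear_sums]])
next
  case False
  have "u\<^sup>2 * (exp x - 1 - x) \<le> u\<^sup>2 * (x\<^sup>2 / 2)"
    using False exp_le_quadratic_of_nonpos[of x] by (intro mult_left_mono) auto
  also have "\<dots> = x\<^sup>2 * (u\<^sup>2 / 2)" by simp
  also have "\<dots> \<le> x\<^sup>2 * (exp u - 1 - u)"
    using assms exp_lower_Taylor_quadratic[of u] by (intro mult_left_mono) auto
  finally show ?thesis .
qed

text \<open>Monotonicity of the ratio at \<open>l * y \<le> l * b\<close>, after cancelling
  \<open>l\<^sup>2\<close>. The quadratic majorant is tangent to the exponential at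
  \<open>y = 0\<close> and meets it again at \<open>y = b\<close>.\<close>

lemma exp_le_bennett:
  fixes y b l :: real
  assumes "y \<le> b" and "0 < b" and "0 < l"
  shows "exp (l * y) \<le> 1 + l * y + (exp (l * b) - 1 - l * b) / b\<^sup>2 * y\<^sup>2"
proof -
  have "(l * b)\<^sup>2 * (exp (l * y) - 1 - l * y) \<le> (l * y)\<^sup>2 * (exp (l * b) - 1 - l * b)"
    using assms by (intro exp_remainder_ratio_mono) auto
  then have "l\<^sup>2 * (b\<^sup>2 * (exp (l * y) - 1 - l * y)) \<le> l\<^sup>2 * (y\<^sup>2 * (exp (l * b) - 1 - l * b))"
    by (simp only: power_mult_distrib mult.assoc)
  then have "b\<^sup>2 * (exp (l * y) - 1 - l * y) \<le> y\<^sup>2 * (exp (l * b) - 1 - l * b)"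
    using assms(3) by simp
  then have "exp (l * y) - 1 - l * y \<le> y\<^sup>2 * (exp (l * b) - 1 - l * b) / b\<^sup>2"
    using assms(2) by (simp add: pos_le_divide_eq mult.commute)
  then show ?thesis by (simp add: mult.commute)
qed

context prob_space
begin

text \<open>If \<open>b \<le> 0\<close>, then \<open>- Y\<close> is almost surely nonnegative with
  mean zero, hence vanishes almost surely, contradicting the positive variance.\<close>

lemma centred_upper_bound_pos:
  fixes Y :: "'a \<Rightarrow> real" and b :: real
  assumes int: "integrable M Y" and mean: "expectation Y = 0"
    and bound: "AE x in M. Y x \<le> b" and var: "0 < expectation (\<lambda>x. (Y x)\<^sup>2)"
  shows "0 < b"
proof (rule ccontr)
  assume "\<not> 0 < b"
  then have nonneg: "AE x in M. 0 \<le> - Y x"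
    by (intro eventually_mono[OF bound]) auto
  have "AE x in M. - Y x = 0"
    using integral_nonneg_eq_0_iff_AE[OF _ nonneg] int mean by simp
  then have "expectation (\<lambda>x. (Y x)\<^sup>2) = expectation (\<lambda>x. 0)"
    using int by (intro integral_cong_AE) auto
  with var show False by simp
qed

lemma integrable_exp_bounded_above:
  fixes Y :: "'a \<Rightarrow> real" and b l :: real
  assumes [measurable]: "random_variable borel Y" and bound: "AE x in M. Y x \<le> b" and "0 \<le> l"
  shows "integrable M (\<lambda>x. exp (l * Y x))"
proof (rule integrable_const_bound)
  show "AE x in M. norm (exp (l * Y x)) \<le> exp (l * b)"
    using bound by eventually_elim (use assms(3) in \<open>auto intro: mult_left_mono\<close>)
qed simp

text \<open>Integrating the quadratic majorant of \<open>exp_le_bennett\<close> kills the linear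
  term, because the mean is zero, and leaves only the variance.\<close>

lemma bennett_mgf_bound:
  fixes Y :: "'a \<Rightarrow> real" and b l :: real
  assumes int: "integrable M Y" and mean: "expectation Y = 0"
    and int2: "integrable M (\<lambda>x. (Y x)\<^sup>2)"
    and bound: "AE x in M. Y x \<le> b" and "0 < b" and "0 < l"
  shows "expectation (\<lambda>x. exp (l * Y x))
    \<le> expectation (\<lambda>x. (Y x)\<^sup>2) / b\<^sup>2 * (exp (l * b) - 1 - l * b) + 1"
proof -
  define c where "c = (exp (l * b) - 1 - l * b) / b\<^sup>2"
  have "expectation (\<lambda>x. exp (l * Y x)) \<le> expectation (\<lambda>x. 1 + l * Y x + c * (Y x)\<^sup>2)"
  proof (rule integral_mono_AE)
    show "integrable M (\<lambda>x. exp (l * Y x))"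
      using int bound assms(6) by (intro integrable_exp_bounded_above) auto
    show "integrable M (\<lambda>x. 1 + l * Y x + c * (Y x)\<^sup>2)"
      using int int2 by simp
    show "AE x in M. exp (l * Y x) \<le> 1 + l * Y x + c * (Y x)\<^sup>2"
      unfolding c_def using assms(5,6) by (intro eventually_mono[OF bound] exp_le_bennett)
  qed
  also have "\<dots> = 1 + c * expectation (\<lambda>x. (Y x)\<^sup>2)"
    using int int2 mean by (simp add: prob_space)
  finally show ?thesis by (simp add: c_def mult.commute)
qed

lemma bennett_chernoff_bound:
  fixes Y :: "'i \<Rightarrow> 'a \<Rightarrow> real" and b :: "'i \<Rightarrow> real" and I :: "'i set" and l a :: real
  assumes fin: "finite I" and indep: "indep_vars (\<lambda>_. borel) Y I"
    and int: "\<And>i. i \<in> I \<Longrightarrow> integrable M (Y i)"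
    and mean: "\<And>i. i \<in> I \<Longrightarrow> expectation (Y i) = 0"
    and int2: "\<And>i. i \<in> I \<Longrightarrow> integrable M (\<lambda>x. (Y i x)\<^sup>2)"
    and bound: "\<And>i. i \<in> I \<Longrightarrow> AE x in M. Y i x \<le> b i"
    and b: "\<And>i. i \<in> I \<Longrightarrow> 0 < b i" and l: "0 < l"
  shows "prob {x \<in> space M. a \<le> (\<Sum>i\<in>I. Y i x)} \<le> exp (- (l * a)) *
    (\<Prod>i\<in>I. expectation (\<lambda>x. (Y i x)\<^sup>2) / (b i)\<^sup>2 * (exp (l * b i) - 1 - l * b i) + 1)"
proof -
  have exp_sum: "(\<lambda>x. exp (l * (\<Sum>i\<in>I. Y i x))) = (\<lambda>x. \<Prod>i\<in>I. exp (l * Y i x))"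
    using fin by (simp add: sum_distrib_left exp_sum)
  have indep': "indep_vars (\<lambda>_. borel) (\<lambda>i x. exp (l * Y i x)) I"
    by (rule indep_vars_compose2[OF indep]) simp
  have int': "integrable M (\<lambda>x. exp (l * Y i x))" if "i \<in> I" for i
    using int[OF that] bound[OF that] l by (intro integrable_exp_bounded_above) auto
  have integ: "integrable M (\<lambda>x. exp (l * (\<Sum>i\<in>I. Y i x)))"
    unfolding exp_sum by (rule indep_vars_integrable[OF fin indep' int'])
  \<comment> \<open>\<open>Chernoff_ineq_ge\<close> speaks of integrals over a set; taking the whole
    space, the result is turned back into an expectation.\<close>
  then have "prob {x \<in> space M. a \<le> (\<Sum>i\<in>I. Y i x)}
      \<le> exp (- l * a) * (\<integral>x\<in>space M. exp (l * (\<Sum>i\<in>I. Y i x)) \<partial>M)"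
    using integrable_mult_indicator[OF sets.top integ] l
    by (intro Chernoff_ineq_ge) (simp_all add: set_integrable_def)
  also have "(\<integral>x\<in>space M. exp (l * (\<Sum>i\<in>I. Y i x)) \<partial>M)
      = expectation (\<lambda>x. exp (l * (\<Sum>i\<in>I. Y i x)))"
    by (rule set_integral_space[OF integ])
  also have "\<dots> = (\<Prod>i\<in>I. expectation (\<lambda>x. exp (l * Y i x)))"
    unfolding exp_sum by (rule indep_vars_lebesgue_integral[OF fin indep' int'])
  \<comment> \<open>Multiplying the factorwise bounds needs nonnegative left-hand factors, which are
    expectations of exponentials.\<close>
  also have "exp (- l * a) * \<dots> \<le> exp (- l * a) *
      (\<Prod>i\<in>I. expectation (\<lambda>x. (Y i x)\<^sup>2) / (b i)\<^sup>2 * (exp (l * b i) - 1 - l * b i) + 1)"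
    by (intro mult_left_mono prod_mono conjI bennett_mgf_bound integral_nonneg int mean int2 bound b l)
       auto
  finally show ?thesis by simp
qed

end

theorem theorem2p2:
  fixes P :: "'a measure"
    and X :: "nat \<Rightarrow> 'a \<Rightarrow> real"
    and n :: nat
    and \<mu> M \<sigma> s\<^sub>i \<theta>\<^sub>i :: "nat \<Rightarrow> real"
    and s t \<theta> :: real
  assumes "prob_space P"
    and "n \<ge> 1"
    and "prob_space.indep_vars P (\<lambda>_. borel) X {1..n}"
    and "\<And>i. i \<in> {1..n} \<Longrightarrow> \<sigma> i > 0"
    and "\<And>i. i \<in> {1..n} \<Longrightarrow> integrable P (X i)"
    and "\<And>i. i \<in> {1..n} \<Longrightarrow> (\<integral>\<omega>. X i \<omega> \<partial>P) = \<mu> i"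
    and "\<And>i. i \<in> {1..n} \<Longrightarrow> integrable P (\<lambda>\<omega>. (X i \<omega> - \<mu> i)\<^sup>2)"
    and "\<And>i. i \<in> {1..n} \<Longrightarrow> (\<integral>\<omega>. (X i \<omega> - \<mu> i)\<^sup>2 \<partial>P) = (\<sigma> i)\<^sup>2"
    and "\<And>i. i \<in> {1..n} \<Longrightarrow> measure P {\<omega> \<in> space P. X i \<omega> \<in> {..M i}} = 1"
    and "\<And>i. i \<in> {1..n} \<Longrightarrow> s\<^sub>i i = M i - \<mu> i"
    and "s = (1 / real n) * (\<Sum>i = 1..n. s\<^sub>i i)"
    and "t \<in> {0<..<s}"
    and "\<And>i. i \<in> {1..n} \<Longrightarrow>
      \<theta>\<^sub>i i = s / (t * s\<^sub>i i) + s\<^sub>i i / (\<sigma> i)\<^sup>2 - 1 / s\<^sub>i i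
        - (1 / s\<^sub>i i) * lambert_W (exp (s / t + (s\<^sub>i i)\<^sup>2 / (\<sigma> i)\<^sup>2 - 1 + ln ((s - t) / t)))"
    and "\<theta> = 1 / (\<Sum>i = 1..n. (s\<^sub>i i)\<^sup>2 / (1 - exp (- ((s\<^sub>i i)\<^sup>2 / (\<sigma> i)\<^sup>2)))) *
      (\<Sum>i = 1..n. ((s\<^sub>i i)\<^sup>2 * \<theta>\<^sub>i i) / (1 - exp (- ((s\<^sub>i i)\<^sup>2 / (\<sigma> i)\<^sup>2))))"
  shows "measure P {\<omega> \<in> space P.
      (1 / real n) * (\<Sum>i = 1..n. X i \<omega>) - (1 / real n) * (\<Sum>i = 1..n. \<integral>\<omega>'. X i \<omega>' \<partial>P) \<ge> t}
    \<le> exp (- (\<theta> * real n * t)) *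
      (\<Prod>i = 1..n. (\<sigma> i)\<^sup>2 / (s\<^sub>i i)\<^sup>2 * (exp (\<theta> * s\<^sub>i i) - 1 - \<theta> * s\<^sub>i i) + 1)"
proof -
  interpret prob_space P by fact
  define Y where "Y i \<omega> = X i \<omega> - \<mu> i" for i \<omega>
  have t: "0 < t" "t < s" using assms(12) by auto
  have Y_int: "integrable P (Y i)" if "i \<in> {1..n}" for i
    unfolding Y_def using assms(5)[OF that] by simp
  have Y_mean: "expectation (Y i) = 0" if "i \<in> {1..n}" for i
    unfolding Y_def using assms(5,6)[OF that] by (simp add: prob_space)
  have Y_bound: "AE \<omega> in P. Y i \<omega> \<le> s\<^sub>i i" if "i \<in> {1..n}" for i
    using assms(10)[OF that]
    by (intro eventually_mono[OF AE_prob_1[OF assms(9)[OF that]]]) (auto simp: Y_def)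
  have Y_sq: "integrable P (\<lambda>\<omega>. (Y i \<omega>)\<^sup>2)" "expectation (\<lambda>\<omega>. (Y i \<omega>)\<^sup>2) = (\<sigma> i)\<^sup>2"
    if "i \<in> {1..n}" for i
    unfolding Y_def using assms(7,8)[OF that] by auto
  have s_pos: "0 < s\<^sub>i i" if "i \<in> {1..n}" for i
    using Y_int[OF that] Y_mean[OF that] Y_bound[OF that]
    by (rule centred_upper_bound_pos) (use Y_sq(2)[OF that] assms(4)[OF that] in simp)
  have Y_indep: "indep_vars (\<lambda>_. borel) Y {1..n}"
    unfolding Y_def[abs_def] by (rule indep_vars_compose2[OF assms(3)]) simp

  have weight_pos: "0 < 1 - exp (- ((s\<^sub>i i)\<^sup>2 / (\<sigma> i)\<^sup>2))" if "i \<in> {1..n}" for i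
    using s_pos[OF that] assms(4)[OF that] by simp
  have \<theta>\<^sub>i_pos: "0 < \<theta>\<^sub>i i" if "i \<in> {1..n}" for i
  proof -
    \<comment> \<open>\<open>A\<close> is the exponent in Lambert's argument without its logarithm,
      and \<open>A / s\<^sub>i i\<close> collects the terms of \<open>\<theta>\<^sub>i i\<close>
      outside \<open>lambert_W\<close>.\<close>
    define A where "A = s / t + (s\<^sub>i i)\<^sup>2 / (\<sigma> i)\<^sup>2 - 1"
    have q: "0 < (s\<^sub>i i)\<^sup>2 / (\<sigma> i)\<^sup>2"
      using s_pos[OF that] assms(4)[OF that] by simp
    have st: "(s - t) / t = s / t - 1" "0 < (s - t) / t"
      using t by (simp_all add: diff_divide_distrib)
    then have A: "(s - t) / t < A" "0 < A"
      using q unfolding A_def by linarith+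
    \<comment> \<open>The logarithm turns into the factor \<open>s / t - 1\<close>, which lies below
      \<open>A\<close> by exactly
      \<open>(s\<^sub>i i)\<^sup>2 / (\<sigma> i)\<^sup>2\<close>.\<close>
    have "exp (A + ln ((s - t) / t)) = (s - t) / t * exp A"
      using st(2) by (simp add: exp_add)
    also have "\<dots> < A * exp A"
      using A(1) by (intro mult_strict_right_mono) auto
    finally have "lambert_W (exp (A + ln ((s - t) / t))) < A"
      using A(2) by (intro lambert_W_less) auto
    moreover have "\<theta>\<^sub>i i = (A - lambert_W (exp (A + ln ((s - t) / t)))) / s\<^sub>i i"
      unfolding assms(13)[OF that] A_def using s_pos[OF that]
      by (simp add: diff_divide_distrib add_divide_distrib power2_eq_square)
    ultimately show ?thesis using s_pos[OF that] by simp
  qed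
  \<comment> \<open>Both sums have positive terms, and they are nonempty since
    \<open>n \<ge> 1\<close>.\<close>
  have \<theta>_pos: "0 < \<theta>"
    unfolding assms(14) using assms(2)
    by (intro mult_pos_pos divide_pos_pos sum_pos zero_less_power s_pos weight_pos \<theta>\<^sub>i_pos) auto

  \<comment> \<open>Multiplying by \<open>n\<close> and absorbing the means into the centred
    variables makes \<open>real n * t\<close> the threshold of the Chernoff bound.\<close>
  have event: "(1 / real n) * (\<Sum>i = 1..n. X i \<omega>) - (1 / real n) * (\<Sum>i = 1..n. \<integral>\<omega>'. X i \<omega>' \<partial>P) \<ge> t
      \<longleftrightarrow> real n * t \<le> (\<Sum>i = 1..n. Y i \<omega>)" for \<omega>
  proof -
    have "(\<Sum>i = 1..n. Y i \<omega>) = (\<Sum>i = 1..n. X i \<omega>) - (\<Sum>i = 1..n. \<integral>\<omega>'. X i \<omega>' \<partial>P)"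
      using assms(6) by (simp add: Y_def sum_subtractf)
    then show ?thesis using assms(2) by (simp only:) (simp add: field_simps)
  qed
  have "prob {\<omega> \<in> space P. real n * t \<le> (\<Sum>i = 1..n. Y i \<omega>)} \<le> exp (- (\<theta> * (real n * t))) *
      (\<Prod>i = 1..n. expectation (\<lambda>\<omega>. (Y i \<omega>)\<^sup>2) / (s\<^sub>i i)\<^sup>2 * (exp (\<theta> * s\<^sub>i i) - 1 - \<theta> * s\<^sub>i i) + 1)"
    using Y_indep Y_int Y_mean Y_sq(1) Y_bound s_pos \<theta>_pos by (intro bennett_chernoff_bound) auto
  also have "(\<Prod>i = 1..n. expectation (\<lambda>\<omega>. (Y i \<omega>)\<^sup>2) / (s\<^sub>i i)\<^sup>2 * (exp (\<theta> * s\<^sub>i i) - 1 - \<theta> * s\<^sub>i i) + 1)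
      = (\<Prod>i = 1..n. (\<sigma> i)\<^sup>2 / (s\<^sub>i i)\<^sup>2 * (exp (\<theta> * s\<^sub>i i) - 1 - \<theta> * s\<^sub>i i) + 1)"
    by (intro prod.cong refl) (simp only: Y_sq(2))
  finally show ?thesis
    unfolding event by (simp only: mult.assoc)
qed

end
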